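(* Let $(X_i,d_i)$, $i=1,2,3$, be nonempty complete metric spaces, let $\mathcal F_i:X_1\times X_2\times X_3\to X_i$, $i=1,2,3$, be mappings, and let $S:X_1\times X_2\times X_3\to X_1\times X_2\times X_3$ be the hierarchical map generated by $(\mathcal F_1,\mathcal F_2,\mathcal F_3)$. Assume that there exist non-negative constants $k_1,k_2,k_3$ such that $k_1+2k_2+2k_3<1$ and, for all $\overline{x}=(x,y,z)$ and $\overline{u}=(u,v,w)$ in $X_1\times X_2\times X_3$, $$M_1(S(\overline{x}),S(\overline{u}))\le k_1\,M_1(\overline{x},\overline{u})+k_2\,M_2^{S}(\overline{x},\overline{u})+k_3\,M_3^{S}(\overline{x},\overline{u}).$$ Then: 1. There exists a unique $\overline{x}^{\,*}=(x^*,y^*,z^* )\in X_1\times X_2\times X_3$ such that $\overline{x}^{\,*}=S(\overline{x}^{\,*})$. In particular, $\overline{x}^{\,*}$ is the unique mixed tripled fixed point of $(\mathcal F_1,\mathcal F_2,\mathcal F_3)$ with respect to the hierarchical architecture. 2. For any initial point $\overline{x}_0=(x_0,y_0,z_0)\in X_1\times X_2\times X_3$, the Picard iteration $\overline{x}_{n+1}:=S(\overline{x}_n)$ converges to $\overline{x}^{\,*}$. 3. Let $k=\frac{k_1+k_2+k_3}{1-k_2-k_3}$. Then, for all $n\ge 1$: (a priori estimate) $M_1(\overline{x}_n,\overline{x}^{\,*})\le \frac{k^n}{1-k}M_1(\overline{x}_1,\overline{x}_0)$; (a posteriori estimate) $M_1(\overline{x}_n,\overline{x}^{\,*})\le \frac{k}{1-k}M_1(\overline{x}_n,\overline{x}_{n-1})$;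 (rate of convergence) $M_1(\overline{x}_n,\overline{x}^{\,*})\le k\,M_1(\overline{x}_{n-1},\overline{x}^{\,*})$. If in addition $X_1=X_2=X_3=X$, $d_1=d_2=d_3=d$, and $S$ satisfies the local triple cross-symmetry property at $(x^*,y^*,z^* )$, then $x^*=y^*=z^*$.
   Context: Hierarchical map. Given nonempty sets $X_1,X_2,X_3$ and maps $\mathcal F_i:X_1\times X_2\times X_3\to X_i$, the hierarchical map $S=(S^1,S^2,S^3):X_1\times X_2\times X_3\to X_1\times X_2\times X_3$ generated by $(\mathcal F_1,\mathcal F_2,\mathcal F_3)$ is defined by $S^3(x,y,z)=\mathcal F_3(x,y,z)$, $S^2(x,y,z)=\mathcal F_2(x,y,S^3(x,y,z))$, $S^1(x,y,z)=\mathcal F_1(x,S^2(x,y,z),S^3(x,y,z))$. Mixed tripled fixed point. A point $\overline{x}^{\,*}\in X_1\times X_2\times X_3$ is a mixed tripled fixed point of $(\mathcal F_1,\mathcal F_2,\mathcal F_3)$ with respect to the hierarchical architecture if $S(\overline{x}^{\,*})=\overline{x}^{\,*}$. Distances. For $\overline{x}=(x,y,z)$, $\overline{u}=(u,v,w)$ in $X_1\times X_2\times X_3$: $M_1(\overline{x},\overline{u})=d_1(x,u)+d_2(y,v)+d_3(z,w)$, $M_2^S(\overline{x},\overline{u})=M_1(\overline{x},S(\overline{x}))+M_1(\overline{u},S(\overline{u}))$, $M_3^S(\overline{x},\overline{u})=M_1(\overline{x},S(\overline{u}))+M_1(\overline{u},S(\overline{x}))$. Convergence in $X_1\times X_2\times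 X_3$ is with respect to $M_1$. Local triple cross-symmetry. When $X_1=X_2=X_3=X$, the map $S=(S^1,S^2,S^3):X^3\to X^3$ satisfies the local triple cross-symmetry property at $(x^*,y^*,z^* )\in X^3$ if $S^1(y^*,z^*,x^* )=S^2(x^*,y^*,z^* )$, $S^2(y^*,z^*,x^* )=S^3(x^*,y^*,z^* )$, and $S^3(y^*,z^*,x^* )=S^1(x^*,y^*,z^* )$. *)

theory Defs
  imports "HOL-Analysis.Analysis"
begin

definition hier3 :: "('a \<times> 'b \<times> 'c \<Rightarrow> 'c) \<Rightarrow> 'a \<times> 'b \<times> 'c \<Rightarrow> 'c" where
  "hier3 F3 = (\<lambda>(x, y, z). F3 (x, y, z))"

definition hier2 ::
  "('a \<times> 'b \<times> 'c \<Rightarrow> 'b) \<Rightarrow> ('a \<times> 'b \<times> 'c \<Rightarrow> 'c) \<Rightarrow> 'a \<times> 'b \<times> 'c \<Rightarrow> 'b" where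
  "hier2 F2 F3 = (\<lambda>(x, y, z). F2 (x, y, hier3 F3 (x, y, z)))"

definition hier1 ::
  "('a \<times> 'b \<times> 'c \<Rightarrow> 'a) \<Rightarrow> ('a \<times> 'b \<times> 'c \<Rightarrow> 'b) \<Rightarrow> ('a \<times> 'b \<times> 'c \<Rightarrow> 'c)
    \<Rightarrow> 'a \<times> 'b \<times> 'c \<Rightarrow> 'a" where
  "hier1 F1 F2 F3 = (\<lambda>(x, y, z). F1 (x, hier2 F2 F3 (x, y, z), hier3 F3 (x, y, z)))"

definition hierarchical_map ::
  "('a \<times> 'b \<times> 'c \<Rightarrow> 'a) \<Rightarrow> ('a \<times> 'b \<times> 'c \<Rightarrow> 'b) \<Rightarrow> ('a \<times> 'b \<times> 'c \<Rightarrow> 'c)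
    \<Rightarrow> 'a \<times> 'b \<times> 'c \<Rightarrow> 'a \<times> 'b \<times> 'c" where
  "hierarchical_map F1 F2 F3 = (\<lambda>p. (hier1 F1 F2 F3 p, hier2 F2 F3 p, hier3 F3 p))"

definition mixed_tripled_fixed_point ::
  "'a set \<Rightarrow> 'b set \<Rightarrow> 'c set
    \<Rightarrow> ('a \<times> 'b \<times> 'c \<Rightarrow> 'a) \<Rightarrow> ('a \<times> 'b \<times> 'c \<Rightarrow> 'b) \<Rightarrow> ('a \<times> 'b \<times> 'c \<Rightarrow> 'c)
    \<Rightarrow> 'a \<times> 'b \<times> 'c \<Rightarrow> bool" where
  "mixed_tripled_fixed_point X1 X2 X3 F1 F2 F3 p \<longleftrightarrow>
     p \<in> X1 \<times> X2 \<times> X3 \<and> hierarchical_map F1 F2 F3 p = p"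

definition dist_M1 ::
  "('a \<Rightarrow> 'a \<Rightarrow> real) \<Rightarrow> ('b \<Rightarrow> 'b \<Rightarrow> real) \<Rightarrow> ('c \<Rightarrow> 'c \<Rightarrow> real)
    \<Rightarrow> 'a \<times> 'b \<times> 'c \<Rightarrow> 'a \<times> 'b \<times> 'c \<Rightarrow> real" where
  "dist_M1 d1 d2 d3 = (\<lambda>(x, y, z) (u, v, w). d1 x u + d2 y v + d3 z w)"

definition dist_M2 ::
  "('a \<Rightarrow> 'a \<Rightarrow> real) \<Rightarrow> ('b \<Rightarrow> 'b \<Rightarrow> real) \<Rightarrow> ('c \<Rightarrow> 'c \<Rightarrow> real)
    \<Rightarrow> ('a \<times> 'b \<times> 'c \<Rightarrow> 'a \<times> 'b \<times> 'c) \<Rightarrow> 'a \<times> 'b \<times> 'c \<Rightarrow> 'a \<times> 'b \<times> 'c \<Rightarrow> real" where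
  "dist_M2 d1 d2 d3 S p q = dist_M1 d1 d2 d3 p (S p) + dist_M1 d1 d2 d3 q (S q)"

definition dist_M3 ::
  "('a \<Rightarrow> 'a \<Rightarrow> real) \<Rightarrow> ('b \<Rightarrow> 'b \<Rightarrow> real) \<Rightarrow> ('c \<Rightarrow> 'c \<Rightarrow> real)
    \<Rightarrow> ('a \<times> 'b \<times> 'c \<Rightarrow> 'a \<times> 'b \<times> 'c) \<Rightarrow> 'a \<times> 'b \<times> 'c \<Rightarrow> 'a \<times> 'b \<times> 'c \<Rightarrow> real" where
  "dist_M3 d1 d2 d3 S p q = dist_M1 d1 d2 d3 p (S q) + dist_M1 d1 d2 d3 q (S p)"

text \<open>The locale \<open>Metric_space\<close> requires nonnegativity and symmetry of the distance on the
  whole type, not only on the carrier. This costs no generality, because a metric on the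
  carrier extends by zero; all other requirements are relative to the carrier.\<close>

definition nonempty_complete_metric :: "'a set \<Rightarrow> ('a \<Rightarrow> 'a \<Rightarrow> real) \<Rightarrow> bool" where
  "nonempty_complete_metric X d \<longleftrightarrow>
     X \<noteq> {} \<and> Metric_space X d \<and> Metric_space.mcomplete X d"

definition hierarchical_contraction ::
  "'a set \<Rightarrow> ('a \<Rightarrow> 'a \<Rightarrow> real) \<Rightarrow> 'b set \<Rightarrow> ('b \<Rightarrow> 'b \<Rightarrow> real) \<Rightarrow> 'c set \<Rightarrow> ('c \<Rightarrow> 'c \<Rightarrow> real)
    \<Rightarrow> ('a \<times> 'b \<times> 'c \<Rightarrow> 'a) \<Rightarrow> ('a \<times> 'b \<times> 'c \<Rightarrow> 'b) \<Rightarrow> ('a \<times> 'b \<times> 'c \<Rightarrow> 'c)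
    \<Rightarrow> real \<Rightarrow> real \<Rightarrow> real \<Rightarrow> bool" where
  "hierarchical_contraction X1 d1 X2 d2 X3 d3 F1 F2 F3 k1 k2 k3 \<longleftrightarrow>
     nonempty_complete_metric X1 d1 \<and>
     nonempty_complete_metric X2 d2 \<and>
     nonempty_complete_metric X3 d3 \<and>
     F1 \<in> X1 \<times> X2 \<times> X3 \<rightarrow> X1 \<and>
     F2 \<in> X1 \<times> X2 \<times> X3 \<rightarrow> X2 \<and>
     F3 \<in> X1 \<times> X2 \<times> X3 \<rightarrow> X3 \<and>
     (let S = hierarchical_map F1 F2 F3 in
       \<forall>p \<in> X1 \<times> X2 \<times> X3. \<forall>q \<in> X1 \<times> X2 \<times> X3.
         dist_M1 d1 d2 d3 (S p) (S q)
           \<le> k1 * dist_M1 d1 d2 d3 p q + k2 * dist_M2 d1 d2 d3 S p q + k3 * dist_M3 d1 d2 d3 S p q)"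

definition local_triple_cross_symmetry ::
  "('a \<times> 'a \<times> 'a \<Rightarrow> 'a \<times> 'a \<times> 'a) \<Rightarrow> 'a \<times> 'a \<times> 'a \<Rightarrow> bool" where
  "local_triple_cross_symmetry S = (\<lambda>(x, y, z).
     let S1 = (\<lambda>p. fst (S p)); S2 = (\<lambda>p. fst (snd (S p))); S3 = (\<lambda>p. snd (snd (S p))) in
       S1 (y, z, x) = S2 (x, y, z) \<and>
       S2 (y, z, x) = S3 (x, y, z) \<and>
       S3 (y, z, x) = S1 (x, y, z))"

end

theory Submission imports Defs begin

text \<open>
  The three-variable structure enters only through the map \<open>S\<close> itself: on the product, with the
  sum \<open>M\<^sub>1\<close> of the three distances, the hypothesis says that \<open>S\<close> is a contraction of
  Hardy--Rogers type on a single metric space, which is complete because its factors are. So the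
  theorem is the fixed point theorem for such contractions.

  That theorem rests on three inequalities, each a few triangle inequalities away from the
  contraction condition, in terms of the residual \<open>d p (S p)\<close>. The residual shrinks by the
  factor \<open>k\<close> at each application of \<open>S\<close> (\<open>residual_step\<close>). The distance of any two points is
  bounded by a multiple of the sum of their residuals (\<open>dist_le_residuals\<close>). The distance to a
  fixed point shrinks by the factor \<open>k\<close> (\<open>step_to_fixed_point\<close>). The first two make every Picard
  orbit a Cauchy sequence. The map \<open>S\<close> need not be continuous, so the limit is shown to be fixed
  by bounding its residual by quantities that vanish along the orbit (\<open>residual_le_near\<close>).
  Uniqueness is the second inequality for residuals zero. The third is the rate of convergence;
  one triangle inequality turns it into the a posteriori estimate, and the geometric decay of the
  residuals turns that into the a priori estimate and into convergence.

  For the last claim, cross-symmetry at a fixed point \<open>(x, y, z)\<close> says that the rotated point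
  \<open>(y, z, x)\<close> is fixed as well, so that uniqueness forces \<open>x = y = z\<close>.
\<close>

section \<open>The sum metric on a product\<close>

definition sum_dist :: "('a \<Rightarrow> 'a \<Rightarrow> real) \<Rightarrow> ('b \<Rightarrow> 'b \<Rightarrow> real) \<Rightarrow> 'a \<times> 'b \<Rightarrow> 'a \<times> 'b \<Rightarrow> real" where
  "sum_dist d e p q = d (fst p) (fst q) + e (snd p) (snd q)"

lemma Metric_space_sum_dist:
  assumes "Metric_space X d" "Metric_space Y e"
  shows "Metric_space (X \<times> Y) (sum_dist d e)"
proof -
  interpret X: Metric_space X d by fact
  interpret Y: Metric_space Y e by fact
  show ?thesis
  proof
    fix p q :: "'a \<times> 'b"
    show "0 \<le> sum_dist d e p q"
      by (simp add: sum_dist_def)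
    show "sum_dist d e p q = sum_dist d e q p"
      by (simp add: sum_dist_def X.commute Y.commute)
    show "sum_dist d e p q = 0 \<longleftrightarrow> p = q" if "p \<in> X \<times> Y" "q \<in> X \<times> Y"
      using that by (auto simp: sum_dist_def add_nonneg_eq_0_iff)
  next
    fix p q r
    assume "p \<in> X \<times> Y" "q \<in> X \<times> Y" "r \<in> X \<times> Y"
    then have "d (fst p) (fst r) \<le> d (fst p) (fst q) + d (fst q) (fst r)"
      and "e (snd p) (snd r) \<le> e (snd p) (snd q) + e (snd q) (snd r)"
      by (auto intro: X.triangle Y.triangle)
    then show "sum_dist d e p r \<le> sum_dist d e p q + sum_dist d e q r"
      by (simp add: sum_dist_def)
  qed
qed

text \<open>Either summand is at most the whole, so the components of a Cauchy sequence are Cauchy, and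
  the pair of their limits is a limit because a sum of null sequences is null.\<close>

lemma mcomplete_sum_dist:
  assumes "Metric_space X d" "Metric_space Y e"
    and "Metric_space.mcomplete X d" "Metric_space.mcomplete Y e"
  shows "Metric_space.mcomplete (X \<times> Y) (sum_dist d e)"
proof -
  interpret X: Metric_space X d by fact
  interpret Y: Metric_space Y e by fact
  interpret XY: Metric_space "X \<times> Y" "sum_dist d e"
    using assms by (simp add: Metric_space_sum_dist)
  show ?thesis
    unfolding XY.mcomplete_def
  proof (intro allI impI)
    fix \<sigma>
    assume \<sigma>: "XY.MCauchy \<sigma>"
    have le: "d (fst p) (fst q) \<le> sum_dist d e p q" "e (snd p) (snd q) \<le> sum_dist d e p q" for p q
      by (simp_all add: sum_dist_def)
    have in_XY: "\<sigma> n \<in> X \<times> Y" for n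
      using \<sigma> by (auto simp: XY.MCauchy_def)
    have ev: "\<exists>N. \<forall>n n'. N \<le> n \<longrightarrow> N \<le> n' \<longrightarrow> sum_dist d e (\<sigma> n) (\<sigma> n') < \<epsilon>" if "\<epsilon> > 0" for \<epsilon>
      using \<sigma> that by (auto simp: XY.MCauchy_def)
    have "X.MCauchy (\<lambda>n. fst (\<sigma> n))"
      unfolding X.MCauchy_def
    proof (intro conjI allI impI)
      show "range (\<lambda>n. fst (\<sigma> n)) \<subseteq> X"
        using in_XY by (auto simp: mem_Times_iff)
    next
      fix \<epsilon> :: real
      assume "\<epsilon> > 0"
      then obtain N where "sum_dist d e (\<sigma> n) (\<sigma> n') < \<epsilon>" if "N \<le> n" "N \<le> n'" for n n'
        using ev by blast
      then have "d (fst (\<sigma> n)) (fst (\<sigma> n')) < \<epsilon>" if "N \<le> n" "N \<le> n'" for n n'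
        using le_less_trans[OF le(1)] that by simp
      then show "\<exists>N. \<forall>n n'. N \<le> n \<longrightarrow> N \<le> n' \<longrightarrow> d (fst (\<sigma> n)) (fst (\<sigma> n')) < \<epsilon>"
        by blast
    qed
    moreover have "Y.MCauchy (\<lambda>n. snd (\<sigma> n))"
      unfolding Y.MCauchy_def
    proof (intro conjI allI impI)
      show "range (\<lambda>n. snd (\<sigma> n)) \<subseteq> Y"
        using in_XY by (auto simp: mem_Times_iff)
    next
      fix \<epsilon> :: real
      assume "\<epsilon> > 0"
      then obtain N where "sum_dist d e (\<sigma> n) (\<sigma> n') < \<epsilon>" if "N \<le> n" "N \<le> n'" for n n'
        using ev by blast
      then have "e (snd (\<sigma> n)) (snd (\<sigma> n')) < \<epsilon>" if "N \<le> n" "N \<le> n'" for n n'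
        using le_less_trans[OF le(2)] that by simp
      then show "\<exists>N. \<forall>n n'. N \<le> n \<longrightarrow> N \<le> n' \<longrightarrow> e (snd (\<sigma> n)) (snd (\<sigma> n')) < \<epsilon>"
        by blast
    qed
    ultimately obtain x y
      where x: "limitin X.mtopology (\<lambda>n. fst (\<sigma> n)) x sequentially"
        and y: "limitin Y.mtopology (\<lambda>n. snd (\<sigma> n)) y sequentially"
      using assms(3,4) unfolding X.mcomplete_def Y.mcomplete_def by blast
    have "(\<lambda>n. d (fst (\<sigma> n)) x + e (snd (\<sigma> n)) y) \<longlonglongrightarrow> 0 + 0"
      using x y by (intro tendsto_add) (auto simp: X.limitin_metric_dist_null Y.limitin_metric_dist_null)
    then have "limitin XY.mtopology \<sigma> (x, y) sequentially"
      using x y in_XY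
      by (simp add: XY.limitin_metric_dist_null X.limitin_metric_dist_null
          Y.limitin_metric_dist_null sum_dist_def)
    then show "\<exists>p. limitin XY.mtopology \<sigma> p sequentially" ..
  qed
qed

lemma dist_M1_eq_sum_dist: "dist_M1 d1 d2 d3 = sum_dist d1 (sum_dist d2 d3)"
  by (auto simp: fun_eq_iff dist_M1_def sum_dist_def)

lemma complete_metric_dist_M1:
  assumes "nonempty_complete_metric X1 d1" "nonempty_complete_metric X2 d2"
    "nonempty_complete_metric X3 d3"
  shows "Metric_space (X1 \<times> X2 \<times> X3) (dist_M1 d1 d2 d3)"
    and "Metric_space.mcomplete (X1 \<times> X2 \<times> X3) (dist_M1 d1 d2 d3)"
  using assms
  by (simp_all add: dist_M1_eq_sum_dist nonempty_complete_metric_def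
      Metric_space_sum_dist mcomplete_sum_dist)

section \<open>Hardy--Rogers contractions\<close>

locale hardy_rogers = Metric_space M d for M :: "'a set" and d +
  fixes S :: "'a \<Rightarrow> 'a" and k1 k2 k3 :: real
  assumes maps: "p \<in> M \<Longrightarrow> S p \<in> M"
    and nonneg_k: "0 \<le> k1" "0 \<le> k2" "0 \<le> k3"
    and small_k: "k1 + 2 * k2 + 2 * k3 < 1"
    and contraction: "\<lbrakk>p \<in> M; q \<in> M\<rbrakk> \<Longrightarrow>
      d (S p) (S q) \<le> k1 * d p q + k2 * (d p (S p) + d q (S q)) + k3 * (d p (S q) + d q (S p))"
begin

definition rate :: real where
  "rate = (k1 + k2 + k3) / (1 - k2 - k3)"

lemma rate_bounds: "0 \<le> rate" "rate < 1"
  using nonneg_k small_k by (simp_all add: rate_def divide_simps)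

text \<open>How the rate arises: when the contraction condition is estimated by triangle inequalities,
  the distance \<open>b\<close> after a step reappears on the right with weight \<open>k2 + k3\<close>, and the distance \<open>a\<close>
  before it has total weight \<open>k1 + k2 + k3\<close>.\<close>

lemma le_rate_mult:
  assumes "b \<le> (k1 + k2 + k3) * a + (k2 + k3) * b"
  shows "b \<le> rate * a"
proof -
  have "0 < 1 - k2 - k3"
    using nonneg_k small_k by linarith
  moreover have "b * (1 - k2 - k3) \<le> (k1 + k2 + k3) * a"
    using assms by (simp add: algebra_simps)
  ultimately show ?thesis
    by (simp add: rate_def pos_le_divide_eq)
qed

text \<open>The contraction condition is applied to \<open>p\<close> and \<open>S p\<close>, so that one of the two crossed
  distances vanishes and the other one is at most the sum of two consecutive residuals.\<close>

lemma residual_step: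
  assumes "p \<in> M"
  shows "d (S p) (S (S p)) \<le> rate * d p (S p)"
proof (rule le_rate_mult)
  have "d p (S (S p)) \<le> d p (S p) + d (S p) (S (S p))"
    using assms by (simp add: triangle maps)
  then have "k3 * d p (S (S p)) \<le> k3 * (d p (S p) + d (S p) (S (S p)))"
    using nonneg_k by (intro mult_left_mono)
  with contraction[of p "S p"] assms
  show "d (S p) (S (S p)) \<le> (k1 + k2 + k3) * d p (S p) + (k2 + k3) * d (S p) (S (S p))"
    by (simp add: maps algebra_simps)
qed

lemma step_to_fixed_point:
  assumes "p \<in> M" "q \<in> M" "S q = q"
  shows "d (S p) q \<le> rate * d p q"
proof (rule le_rate_mult)
  have "d p (S p) \<le> d p q + d (S p) q"
    using assms by (simp add: triangle' maps)
  then have "k2 * d p (S p) \<le> k2 * (d p q + d (S p) q)"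
    using nonneg_k by (intro mult_left_mono)
  with contraction[of p q] assms
  show "d (S p) q \<le> (k1 + k2 + k3) * d p q + (k2 + k3) * d (S p) q"
    by (simp add: commute[of q "S p"] algebra_simps)
qed

text \<open>Two points that are almost fixed are close to each other. This gives uniqueness at once, and
  it spares the summation of a geometric series in the proof that Picard orbits are Cauchy.\<close>

lemma dist_le_residuals:
  assumes "p \<in> M" "q \<in> M"
  shows "d p q \<le> (1 + k2 + k3) / (1 - k1 - 2 * k3) * (d p (S p) + d q (S q))"
proof -
  have "0 < 1 - k1 - 2 * k3"
    using nonneg_k small_k by linarith
  moreover have "d p q * (1 - k1 - 2 * k3) \<le> (1 + k2 + k3) * (d p (S p) + d q (S q))"
  proof -
    have "d p q \<le> d p (S p) + d (S p) q" "d (S p) q \<le> d (S p) (S q) + d q (S q)"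
      using assms by (simp_all add: triangle triangle' maps)
    moreover have "k3 * (d p (S q) + d q (S p)) \<le> k3 * (d p q + d q (S q) + (d p q + d p (S p)))"
      using assms nonneg_k triangle[of p q "S q"] triangle[of q p "S p"]
      by (intro mult_left_mono add_mono) (simp_all add: maps commute[of q p])
    moreover note contraction[OF assms]
    ultimately show ?thesis
      by (simp add: algebra_simps)
  qed
  ultimately show ?thesis
    by (simp add: pos_le_divide_eq)
qed

lemma fixed_point_unique:
  assumes "p \<in> M" "q \<in> M" "S p = p" "S q = q"
  shows "p = q"
proof -
  have "d p q \<le> 0"
    using dist_le_residuals[of p q] assms by simp
  then show ?thesis
    using assms by (metis nonneg order_antisym zero)
qed

text \<open>A continuity substitute: the residual of \<open>q\<close> is small as soon as some \<open>p\<close> with small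
  residual lies close to \<open>q\<close>.\<close>

lemma residual_le_near:
  assumes "p \<in> M" "q \<in> M"
  shows "(1 - k2 - k3) * d q (S q) \<le> (1 + k3) * d (S p) q + (k1 + k3) * d p q + k2 * d p (S p)"
proof -
  have "d q (S q) \<le> d (S p) q + d (S p) (S q)"
    using assms by (simp add: triangle'' maps)
  moreover have "k3 * (d p (S q) + d q (S p)) \<le> k3 * (d p q + d q (S q) + d (S p) q)"
    using assms nonneg_k triangle[of p q "S q"]
    by (intro mult_left_mono add_mono) (simp_all add: maps commute[of q "S p"])
  moreover note contraction[OF assms]
  ultimately show ?thesis
    by (simp add: algebra_simps)
qed

section \<open>Picard iteration\<close>

lemma funpow_in: "p \<in> M \<Longrightarrow> (S ^^ n) p \<in> M"
  by (induction n) (simp_all add: maps)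

lemma residual_funpow:
  assumes "p \<in> M"
  shows "d ((S ^^ n) p) ((S ^^ Suc n) p) \<le> rate ^ n * d p (S p)"
proof (induction n)
  case (Suc n)
  have "d ((S ^^ Suc n) p) ((S ^^ Suc (Suc n)) p) \<le> rate * d ((S ^^ n) p) ((S ^^ Suc n) p)"
    using residual_step[of "(S ^^ n) p"] assms by (simp add: funpow_in)
  also have "\<dots> \<le> rate * (rate ^ n * d p (S p))"
    using Suc rate_bounds by (intro mult_left_mono)
  finally show ?case
    by (simp add: mult.assoc)
qed simp

lemma residual_tendsto_0:
  assumes "p \<in> M"
  shows "(\<lambda>n. d ((S ^^ n) p) ((S ^^ Suc n) p)) \<longlonglongrightarrow> 0"
proof (rule tendsto_sandwich[where f = "\<lambda>_. 0"])
  show "\<forall>\<^sub>F n in sequentially. d ((S ^^ n) p) ((S ^^ Suc n) p) \<le> rate ^ n * d p (S p)"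
    using residual_funpow[OF assms] by simp
  show "(\<lambda>n. rate ^ n * d p (S p)) \<longlonglongrightarrow> 0"
    using rate_bounds by (intro tendsto_mult_left_zero LIMSEQ_realpow_zero)
qed simp_all

lemma MCauchy_funpow:
  assumes "p \<in> M"
  shows "MCauchy (\<lambda>n. (S ^^ n) p)"
  unfolding MCauchy_def
proof (intro conjI allI impI)
  show "range (\<lambda>n. (S ^^ n) p) \<subseteq> M"
    using assms by (auto simp: funpow_in)
next
  fix \<epsilon> :: real
  assume "\<epsilon> > 0"
  define C where "C = (1 + k2 + k3) / (1 - k1 - 2 * k3)"
  have "(\<lambda>n. C * d ((S ^^ n) p) ((S ^^ Suc n) p)) \<longlonglongrightarrow> 0"
    by (intro tendsto_mult_right_zero residual_tendsto_0 assms)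
  then have "\<forall>\<^sub>F n in sequentially. C * d ((S ^^ n) p) ((S ^^ Suc n) p) < \<epsilon> / 2"
    using \<open>\<epsilon> > 0\<close> by (intro order_tendstoD(2)) auto
  then obtain N where N: "C * d ((S ^^ n) p) ((S ^^ Suc n) p) < \<epsilon> / 2" if "N \<le> n" for n
    by (auto simp: eventually_sequentially)
  have "d ((S ^^ n) p) ((S ^^ n') p) < \<epsilon>" if "N \<le> n" "N \<le> n'" for n n'
  proof -
    have "d ((S ^^ n) p) ((S ^^ n') p)
        \<le> C * d ((S ^^ n) p) ((S ^^ Suc n) p) + C * d ((S ^^ n') p) ((S ^^ Suc n') p)"
      using dist_le_residuals[of "(S ^^ n) p" "(S ^^ n') p"] assms
      by (simp add: funpow_in C_def distrib_left)
    with N[of n] N[of n'] that show ?thesis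
      by linarith
  qed
  then show "\<exists>N. \<forall>n n'. N \<le> n \<longrightarrow> N \<le> n' \<longrightarrow> d ((S ^^ n) p) ((S ^^ n') p) < \<epsilon>"
    by blast
qed

lemma fixed_point_exists:
  assumes "mcomplete" "p \<in> M"
  obtains q where "q \<in> M" "S q = q"
proof -
  obtain q where q: "limitin mtopology (\<lambda>n. (S ^^ n) p) q sequentially"
    using assms MCauchy_funpow by (auto simp: mcomplete_def)
  then have "q \<in> M" and lim: "(\<lambda>n. d ((S ^^ n) p) q) \<longlonglongrightarrow> 0"
    by (auto simp: limitin_metric_dist_null)
  have "(\<lambda>n. (1 + k3) * d ((S ^^ Suc n) p) q + (k1 + k3) * d ((S ^^ n) p) q
      + k2 * d ((S ^^ n) p) ((S ^^ Suc n) p)) \<longlonglongrightarrow> (1 + k3) * 0 + (k1 + k3) * 0 + k2 * 0"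
    using assms LIMSEQ_Suc[OF lim]
    by (intro tendsto_intros lim residual_tendsto_0)
  then have "(1 - k2 - k3) * d q (S q) \<le> (1 + k3) * 0 + (k1 + k3) * 0 + k2 * 0"
    using residual_le_near[OF funpow_in[OF \<open>p \<in> M\<close>] \<open>q \<in> M\<close>]
    by (intro LIMSEQ_le_const) auto
  moreover have "0 < 1 - k2 - k3"
    using nonneg_k small_k by linarith
  ultimately have "d q (S q) \<le> 0"
    by (simp add: mult_le_0_iff)
  then have "S q = q"
    using \<open>q \<in> M\<close> by (metis maps nonneg order_antisym zero)
  with \<open>q \<in> M\<close> that show thesis
    by blast
qed

lemma funpow_rate:
  assumes "p \<in> M" "q \<in> M" "S q = q"
  shows "d ((S ^^ Suc n) p) q \<le> rate * d ((S ^^ n) p) q"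
  using step_to_fixed_point[of "(S ^^ n) p" q] assms by (simp add: funpow_in)

text \<open>The rate estimate bounds the new error by the old one, and the old one exceeds the new one by
  at most the last step taken; solving for the new error gives the factor \<open>rate / (1 - rate)\<close>.\<close>

lemma funpow_a_posteriori:
  assumes "p \<in> M" "q \<in> M" "S q = q"
  shows "d ((S ^^ Suc n) p) q \<le> rate / (1 - rate) * d ((S ^^ Suc n) p) ((S ^^ n) p)"
proof -
  have "rate * d ((S ^^ n) p) q \<le> rate * (d ((S ^^ Suc n) p) ((S ^^ n) p) + d ((S ^^ Suc n) p) q)"
    using assms rate_bounds by (intro mult_left_mono triangle'' funpow_in)
  with funpow_rate[OF assms, of n]
  have "d ((S ^^ Suc n) p) q * (1 - rate) \<le> rate * d ((S ^^ Suc n) p) ((S ^^ n) p)"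
    by (simp add: algebra_simps)
  then show ?thesis
    using rate_bounds by (simp add: pos_le_divide_eq)
qed

lemma funpow_a_priori:
  assumes "p \<in> M" "q \<in> M" "S q = q"
  shows "d ((S ^^ Suc n) p) q \<le> rate ^ Suc n / (1 - rate) * d (S p) p"
proof -
  have "d ((S ^^ Suc n) p) ((S ^^ n) p) \<le> rate ^ n * d (S p) p"
    using residual_funpow[OF \<open>p \<in> M\<close>, of n] by (simp add: commute)
  then have "rate / (1 - rate) * d ((S ^^ Suc n) p) ((S ^^ n) p)
      \<le> rate / (1 - rate) * (rate ^ n * d (S p) p)"
    using rate_bounds by (intro mult_left_mono) auto
  with funpow_a_posteriori[OF assms, of n] show ?thesis
    by simp
qed

lemma funpow_limit:
  assumes "p \<in> M" "q \<in> M" "S q = q"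
  shows "limitin mtopology (\<lambda>n. (S ^^ n) p) q sequentially"
proof -
  have "(\<lambda>n. d ((S ^^ Suc n) p) q) \<longlonglongrightarrow> 0"
  proof (rule tendsto_sandwich[where f = "\<lambda>_. 0"])
    show "\<forall>\<^sub>F n in sequentially. d ((S ^^ Suc n) p) q
        \<le> rate / (1 - rate) * d ((S ^^ n) p) ((S ^^ Suc n) p)"
      using funpow_a_posteriori[OF assms] by (simp add: commute)
    show "(\<lambda>n. rate / (1 - rate) * d ((S ^^ n) p) ((S ^^ Suc n) p)) \<longlonglongrightarrow> 0"
      by (intro tendsto_mult_right_zero residual_tendsto_0 assms)
  qed simp_all
  then have "(\<lambda>n. d ((S ^^ n) p) q) \<longlonglongrightarrow> 0"
    by (rule LIMSEQ_imp_Suc)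
  then show ?thesis
    using assms by (simp add: limitin_metric_dist_null funpow_in)
qed

end

section \<open>Hierarchical maps\<close>

lemma hierarchical_map_in:
  assumes "F1 \<in> X1 \<times> X2 \<times> X3 \<rightarrow> X1" "F2 \<in> X1 \<times> X2 \<times> X3 \<rightarrow> X2" "F3 \<in> X1 \<times> X2 \<times> X3 \<rightarrow> X3"
    and "p \<in> X1 \<times> X2 \<times> X3"
  shows "hierarchical_map F1 F2 F3 p \<in> X1 \<times> X2 \<times> X3"
proof -
  obtain x y z where p: "p = (x, y, z)" "x \<in> X1" "y \<in> X2" "z \<in> X3"
    using assms(4) by auto
  have "hier3 F3 p \<in> X3"
    using assms(3) p by (auto simp: hier3_def)
  moreover from this have "hier2 F2 F3 p \<in> X2"
    using assms(2) p by (auto simp: hier2_def)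
  moreover from calculation have "hier1 F1 F2 F3 p \<in> X1"
    using assms(1) p by (auto simp: hier1_def)
  ultimately show ?thesis
    by (simp add: hierarchical_map_def)
qed

lemma hierarchical_contraction_hardy_rogers:
  assumes "hierarchical_contraction X1 d1 X2 d2 X3 d3 F1 F2 F3 k1 k2 k3"
    and "0 \<le> k1" "0 \<le> k2" "0 \<le> k3" "k1 + 2 * k2 + 2 * k3 < 1"
  shows "hardy_rogers (X1 \<times> X2 \<times> X3) (dist_M1 d1 d2 d3) (hierarchical_map F1 F2 F3) k1 k2 k3"
proof (intro hardy_rogers.intro hardy_rogers_axioms.intro)
  show "Metric_space (X1 \<times> X2 \<times> X3) (dist_M1 d1 d2 d3)"
    using assms(1) by (simp add: hierarchical_contraction_def complete_metric_dist_M1)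
  show "hierarchical_map F1 F2 F3 p \<in> X1 \<times> X2 \<times> X3" if "p \<in> X1 \<times> X2 \<times> X3" for p
    using assms(1) that by (intro hierarchical_map_in) (simp_all add: hierarchical_contraction_def)
qed (use assms in \<open>simp_all only: hierarchical_contraction_def Let_def dist_M2_def dist_M3_def\<close>)

lemma cross_symmetry_rotated_fixed_point:
  assumes "local_triple_cross_symmetry S (x, y, z)" "S (x, y, z) = (x, y, z)"
  shows "S (y, z, x) = (y, z, x)"
  using assms by (simp add: local_triple_cross_symmetry_def prod_eq_iff)

theorem theorem1:
  fixes X1 :: "'a set" and d1 :: "'a \<Rightarrow> 'a \<Rightarrow> real"
    and X2 :: "'b set" and d2 :: "'b \<Rightarrow> 'b \<Rightarrow> real"
    and X3 :: "'c set" and d3 :: "'c \<Rightarrow> 'c \<Rightarrow> real"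
    and F1 :: "'a \<times> 'b \<times> 'c \<Rightarrow> 'a"
    and F2 :: "'a \<times> 'b \<times> 'c \<Rightarrow> 'b"
    and F3 :: "'a \<times> 'b \<times> 'c \<Rightarrow> 'c"
    and X :: "'d set" and d :: "'d \<Rightarrow> 'd \<Rightarrow> real"
    and G1 G2 G3 :: "'d \<times> 'd \<times> 'd \<Rightarrow> 'd"
    and k1 k2 k3 :: real
  assumes "0 \<le> k1" "0 \<le> k2" "0 \<le> k3"
    and "k1 + 2 * k2 + 2 * k3 < 1"
  shows
    "(hierarchical_contraction X1 d1 X2 d2 X3 d3 F1 F2 F3 k1 k2 k3 \<longrightarrow>
       (let S = hierarchical_map F1 F2 F3;
            M1 = dist_M1 d1 d2 d3;
            k = (k1 + k2 + k3) / (1 - k2 - k3)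
        in (\<exists>!p. mixed_tripled_fixed_point X1 X2 X3 F1 F2 F3 p) \<and>
           (\<forall>p. mixed_tripled_fixed_point X1 X2 X3 F1 F2 F3 p \<longrightarrow>
             (\<forall>p0 \<in> X1 \<times> X2 \<times> X3.
               limitin (Metric_space.mtopology (X1 \<times> X2 \<times> X3) M1)
                 (\<lambda>n. (S ^^ n) p0) p sequentially \<and>
               (\<forall>n \<ge> 1.
                 M1 ((S ^^ n) p0) p \<le> k ^ n / (1 - k) * M1 ((S ^^ 1) p0) p0 \<and>
                 M1 ((S ^^ n) p0) p \<le> k / (1 - k) * M1 ((S ^^ n) p0) ((S ^^ (n - 1)) p0) \<and>
                 M1 ((S ^^ n) p0) p \<le> k * M1 ((S ^^ (n - 1)) p0) p)))))
     \<and>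
     (hierarchical_contraction X d X d X d G1 G2 G3 k1 k2 k3 \<longrightarrow>
       (\<forall>x y z. mixed_tripled_fixed_point X X X G1 G2 G3 (x, y, z) \<and>
          local_triple_cross_symmetry (hierarchical_map G1 G2 G3) (x, y, z) \<longrightarrow>
          x = y \<and> y = z))"
proof (rule conjI; intro impI)
  assume H: "hierarchical_contraction X1 d1 X2 d2 X3 d3 F1 F2 F3 k1 k2 k3"
  interpret hardy_rogers "X1 \<times> X2 \<times> X3" "dist_M1 d1 d2 d3" "hierarchical_map F1 F2 F3" k1 k2 k3
    using H assms by (rule hierarchical_contraction_hardy_rogers)
  let ?fixed = "mixed_tripled_fixed_point X1 X2 X3 F1 F2 F3"
  let ?S = "hierarchical_map F1 F2 F3"
  let ?M1 = "dist_M1 d1 d2 d3"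
  have "mcomplete"
    using H by (simp add: hierarchical_contraction_def complete_metric_dist_M1)
  moreover obtain p0 where "p0 \<in> X1 \<times> X2 \<times> X3"
    using H unfolding hierarchical_contraction_def nonempty_complete_metric_def by blast
  ultimately obtain q where "q \<in> X1 \<times> X2 \<times> X3" "?S q = q"
    by (rule fixed_point_exists)
  then have ex1: "\<exists>!p. ?fixed p"
    unfolding mixed_tripled_fixed_point_def using fixed_point_unique by blast
  have lim: "limitin mtopology (\<lambda>n. (?S ^^ n) p0) p sequentially"
    if "?fixed p" "p0 \<in> X1 \<times> X2 \<times> X3" for p p0
    using that by (simp add: funpow_limit mixed_tripled_fixed_point_def)
  have estimates: "?M1 ((?S ^^ n) p0) p \<le> rate ^ n / (1 - rate) * ?M1 ((?S ^^ 1) p0) p0 \<and>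
      ?M1 ((?S ^^ n) p0) p \<le> rate / (1 - rate) * ?M1 ((?S ^^ n) p0) ((?S ^^ (n - 1)) p0) \<and>
      ?M1 ((?S ^^ n) p0) p \<le> rate * ?M1 ((?S ^^ (n - 1)) p0) p"
    if fixed: "?fixed p" and p0: "p0 \<in> X1 \<times> X2 \<times> X3" and n: "n \<ge> 1" for p p0 n
  proof -
    have p: "p \<in> X1 \<times> X2 \<times> X3" "?S p = p"
      using fixed by (simp_all add: mixed_tripled_fixed_point_def)
    obtain m where m: "n = Suc m"
      using n by (cases n) auto
    show ?thesis
      using funpow_a_priori[OF p0 p, of m] funpow_a_posteriori[OF p0 p, of m]
        funpow_rate[OF p0 p, of m]
      unfolding m by simp
  qed
  show "let S = ?S; M1 = ?M1; k = (k1 + k2 + k3) / (1 - k2 - k3)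
        in (\<exists>!p. ?fixed p) \<and>
           (\<forall>p. ?fixed p \<longrightarrow>
             (\<forall>p0 \<in> X1 \<times> X2 \<times> X3.
               limitin (Metric_space.mtopology (X1 \<times> X2 \<times> X3) M1)
                 (\<lambda>n. (S ^^ n) p0) p sequentially \<and>
               (\<forall>n \<ge> 1.
                 M1 ((S ^^ n) p0) p \<le> k ^ n / (1 - k) * M1 ((S ^^ 1) p0) p0 \<and>
                 M1 ((S ^^ n) p0) p \<le> k / (1 - k) * M1 ((S ^^ n) p0) ((S ^^ (n - 1)) p0) \<and>
                 M1 ((S ^^ n) p0) p \<le> k * M1 ((S ^^ (n - 1)) p0) p)))"
    unfolding Let_def rate_def[symmetric]
    by (intro conjI allI impI ballI ex1 lim estimates[THEN conjunct1]
        estimates[THEN conjunct2, THEN conjunct1] estimates[THEN conjunct2, THEN conjunct2])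
next
  assume H: "hierarchical_contraction X d X d X d G1 G2 G3 k1 k2 k3"
  interpret hardy_rogers "X \<times> X \<times> X" "dist_M1 d d d" "hierarchical_map G1 G2 G3" k1 k2 k3
    using H assms by (rule hierarchical_contraction_hardy_rogers)
  show "\<forall>x y z. mixed_tripled_fixed_point X X X G1 G2 G3 (x, y, z) \<and>
          local_triple_cross_symmetry (hierarchical_map G1 G2 G3) (x, y, z) \<longrightarrow>
          x = y \<and> y = z"
  proof (intro allI impI, elim conjE)
    fix x y z
    assume "mixed_tripled_fixed_point X X X G1 G2 G3 (x, y, z)"
      and sym: "local_triple_cross_symmetry (hierarchical_map G1 G2 G3) (x, y, z)"
    then have "(x, y, z) \<in> X \<times> X \<times> X" "hierarchical_map G1 G2 G3 (x, y, z) = (x, y, z)"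
      by (auto simp: mixed_tripled_fixed_point_def)
    moreover from sym this(2) have "hierarchical_map G1 G2 G3 (y, z, x) = (y, z, x)"
      by (rule cross_symmetry_rotated_fixed_point)
    ultimately have "(x, y, z) = (y, z, x)"
      using fixed_point_unique[of "(x, y, z)" "(y, z, x)"] by blast
    then show "x = y \<and> y = z"
      by blast
  qed
qed

end
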